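(* Let $X$ be a (real or complex) Banach space, let $X_1,\dots,X_n$ be complemented subspaces of $X$, let $m\geqslant 1$ be a natural number and let $\alpha$ be a norm on the algebraic tensor power $X^{\otimes m}$. Assume that $\alpha$ has the following property (P1): whenever $A_1:X\to X,\dots,A_m:X\to X$ are bounded linear operators, the operator $A_1\otimes\dots\otimes A_m:(X^{\otimes m})_\alpha\to(X^{\otimes m})_\alpha$ is bounded. Assume also that $m\geqslant n-1$. If $X_i\cap X_j=\{0\}$ and $X_i+X_j$ is complemented in $X$ for each pair of distinct indices $i,j$, then the subspaces $X_1^m,\dots,X_n^m$ of $X^m$ are linearly independent and their sum is complemented in $X^m$.
   Context: $X^{\otimes m}=X\otimes\dots\otimes X$ ($m$ copies) is the algebraic tensor product (merely a vector space), and $X_i^{\otimes m}=X_i\otimes\dots\otimes X_i$ is regarded as a subspace of it. $(X^{\otimes m})_\alpha$ is the vector space $X^{\otimes m}$ endowed with the norm $\alpha$; $X^m=X^m(\alpha)$ is its completion, and $X_i^m$ is the closure of $X_i^{\otimes m}$ in $X^m$. A subspace $M$ of a Banach space $Y$ is complemented in $Y$ if there is a continuous linear projection of $Y$ onto $M$. Subspaces $Y_1,\dots,Y_n$ are linearly independent if $y_1+\dots+y_n=0$ with $y_i\in Y_i$ implies all $y_i=0$. *)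

theory Defs
  imports "HOL-Analysis.Analysis" "HOL-Library.Function_Algebras" "HOL-Library.Set_Algebras"
begin

section \<open>Banach spaces over the real or complex field\<close>

text \<open>
  The scalar field is a type of class \<open>real_normed_field\<close>. Its two instances \<open>real\<close> and
  \<open>complex\<close> are the intended ones; by the Gelfand-Mazur theorem every other instance is
  isometrically isomorphic to one of them. As the library's classes of normed spaces provide only
  multiplication by real scalars, multiplication by the scalars of the field is a separate
  operation \<open>s\<close>, required to extend \<open>scaleR\<close>.
\<close>

locale normed_space_over = vector_space s
  for s :: "'k::real_normed_field \<Rightarrow> 'a::real_normed_vector \<Rightarrow> 'a" +
  assumes scale_of_real: "s (of_real r) x = r *\<^sub>R x"
    and norm_scale: "norm (s c x) = norm c * norm x"

definition bounded_operator ::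
  "('k::real_normed_field \<Rightarrow> 'a::real_normed_vector \<Rightarrow> 'a) \<Rightarrow> ('a \<Rightarrow> 'a) \<Rightarrow> bool" where
  "bounded_operator s A \<longleftrightarrow> Vector_Spaces.linear s s A \<and> bounded_linear A"

definition complemented ::
  "('k::real_normed_field \<Rightarrow> 'a::real_normed_vector \<Rightarrow> 'a) \<Rightarrow> 'a set \<Rightarrow> bool" where
  "complemented s M \<longleftrightarrow> module.subspace s M \<and>
     (\<exists>P. bounded_operator s P \<and> range P \<subseteq> M \<and> (\<forall>x\<in>M. P x = x))"

definition independent_subspaces :: "'i set \<Rightarrow> ('i \<Rightarrow> 'a::comm_monoid_add set) \<Rightarrow> bool" where
  "independent_subspaces I Y \<longleftrightarrow>
     (\<forall>y. (\<forall>i\<in>I. y i \<in> Y i) \<and> (\<Sum>i\<in>I. y i) = 0 \<longrightarrow> (\<forall>i\<in>I. y i = 0))"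

section \<open>Algebraic tensor powers\<close>

text \<open>
  An \<open>m\<close>-tuple is represented by a function on \<open>nat\<close> of which only the values at arguments below
  \<open>m\<close> are relevant; the first conjunct says that \<open>f\<close> ignores the other ones.
\<close>

definition multilinear ::
  "('k::field \<Rightarrow> 'a::ab_group_add \<Rightarrow> 'a) \<Rightarrow> ('k \<Rightarrow> 'b::ab_group_add \<Rightarrow> 'b) \<Rightarrow> nat
    \<Rightarrow> ((nat \<Rightarrow> 'a) \<Rightarrow> 'b) \<Rightarrow> bool" where
  "multilinear s t m f \<longleftrightarrow>
     (\<forall>x y. (\<forall>i<m. x i = y i) \<longrightarrow> f x = f y) \<and>
     (\<forall>i<m. \<forall>x. Vector_Spaces.linear s t (\<lambda>v. f (x(i := v))))"

text \<open>
  The algebraic tensor power is constructed, as is usual for Banach spaces, as a space of linear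
  functionals on the space of \<open>m\<close>-linear forms: \<open>x\<^sub>0 \<otimes> \<dots> \<otimes> x\<^bsub>m-1\<^esub>\<close> is the evaluation of forms at the
  tuple \<open>x\<close>, and the tensor power is the span of these elements. Functionals are
  extended by \<open>0\<close> to functions that are not \<open>m\<close>-linear. The lemmas \<open>multilinear_elem_tensor\<close> and
  \<open>tensor_power_universal\<close> below give the universal property.
\<close>

type_synonym ('k, 'a) tensor = "((nat \<Rightarrow> 'a) \<Rightarrow> 'k) \<Rightarrow> 'k"

definition tensor_scale :: "'k::field \<Rightarrow> ('k, 'a) tensor \<Rightarrow> ('k, 'a) tensor" where
  "tensor_scale c u = (\<lambda>\<phi>. c * u \<phi>)"

definition elem_tensor ::
  "('k::field \<Rightarrow> 'a::ab_group_add \<Rightarrow> 'a) \<Rightarrow> nat \<Rightarrow> (nat \<Rightarrow> 'a) \<Rightarrow> ('k, 'a) tensor" where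
  "elem_tensor s m x = (\<lambda>\<phi>. if multilinear s (*) m \<phi> then \<phi> x else 0)"

text \<open>For a subspace \<open>M\<close> of \<open>X\<close>, this is \<open>M\<^sup>\<otimes>\<^sup>m\<close> as a subspace of \<open>X\<^sup>\<otimes>\<^sup>m\<close>.\<close>

definition tensor_power ::
  "('k::field \<Rightarrow> 'a::ab_group_add \<Rightarrow> 'a) \<Rightarrow> nat \<Rightarrow> 'a set \<Rightarrow> ('k, 'a) tensor set" where
  "tensor_power s m M = module.span tensor_scale {elem_tensor s m x | x. \<forall>i<m. x i \<in> M}"

text \<open>
  \<open>A\<^sub>0 \<otimes> \<dots> \<otimes> A\<^bsub>m-1\<^esub>\<close>, the transpose of precomposition of forms with the \<open>A\<^sub>i\<close>;
  see \<open>tensor_operator_elem\<close> and \<open>tensor_operator_linear\<close> below.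
\<close>

definition tensor_operator ::
  "('k::field \<Rightarrow> 'a::ab_group_add \<Rightarrow> 'a) \<Rightarrow> nat \<Rightarrow> (nat \<Rightarrow> 'a \<Rightarrow> 'a)
    \<Rightarrow> ('k, 'a) tensor \<Rightarrow> ('k, 'a) tensor" where
  "tensor_operator s m A u =
     (\<lambda>\<phi>. if multilinear s (*) m \<phi> then u (\<lambda>x. \<phi> (\<lambda>i. A i (x i))) else 0)"

interpretation tensor: vector_space "tensor_scale :: 'k::field \<Rightarrow> ('k, 'a) tensor \<Rightarrow> ('k, 'a) tensor"
  by standard (auto simp: tensor_scale_def fun_eq_iff algebra_simps)

lemma multilinear_elem_tensor:
  assumes "vector_space s"
  shows "multilinear s tensor_scale m (elem_tensor s m)"
proof -
  interpret vector_space s by fact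
  have "Vector_Spaces.linear s tensor_scale (\<lambda>v. elem_tensor s m (x(i := v)))" if "i < m" for i x
  proof -
    have lin: "Vector_Spaces.linear s (*) (\<lambda>v. \<phi> (x(i := v)))" if "multilinear s (*) m \<phi>" for \<phi>
      using that \<open>i < m\<close> by (auto simp: multilinear_def)
    show ?thesis
      by unfold_locales
        (auto simp: elem_tensor_def tensor_scale_def fun_eq_iff
          module_hom.add[OF lin[unfolded linear_iff_module_hom]]
          module_hom.scale[OF lin[unfolded linear_iff_module_hom]])
  qed
  moreover have "elem_tensor s m x = elem_tensor s m y" if "\<forall>i<m. x i = y i" for x y
    using that by (auto simp: elem_tensor_def multilinear_def fun_eq_iff)
  ultimately show ?thesis by (auto simp: multilinear_def)
qed

lemma tensor_operator_linear: "Vector_Spaces.linear tensor_scale tensor_scale (tensor_operator s m A)"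
  by unfold_locales (auto simp: tensor_operator_def tensor_scale_def fun_eq_iff)

lemma multilinear_comp:
  assumes "multilinear s t m f" and "\<And>i. i < m \<Longrightarrow> Vector_Spaces.linear s s (A i)"
  shows "multilinear s t m (\<lambda>x. f (\<lambda>i. A i (x i)))"
proof -
  have "Vector_Spaces.linear s t (\<lambda>v. f (\<lambda>j. A j ((x(i := v)) j)))" if "i < m" for i x
  proof -
    have "Vector_Spaces.linear s t ((\<lambda>v. f ((\<lambda>j. A j (x j))(i := v))) \<circ> A i)"
      using assms that by (intro Vector_Spaces.linear_compose) (auto simp: multilinear_def)
    moreover have "(\<lambda>j. A j (x j))(i := A i v) = (\<lambda>j. A j ((x(i := v)) j))" for v
      by auto
    ultimately show ?thesis by (simp add: o_def)
  qed
  moreover have "f (\<lambda>i. A i (x i)) = f (\<lambda>i. A i (y i))" if "\<forall>i<m. x i = y i" for x y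
    using that assms(1) by (auto simp: multilinear_def)
  ultimately show ?thesis unfolding multilinear_def by blast
qed

lemma tensor_operator_elem:
  assumes "\<And>i. i < m \<Longrightarrow> Vector_Spaces.linear s s (A i)"
  shows "tensor_operator s m A (elem_tensor s m x) = elem_tensor s m (\<lambda>i. A i (x i))"
proof -
  have "multilinear s (*) m (\<lambda>x. \<phi> (\<lambda>i. A i (x i)))" if "multilinear s (*) m \<phi>" for \<phi>
    using that assms by (rule multilinear_comp)
  then show ?thesis
    by (auto simp: tensor_operator_def elem_tensor_def fun_eq_iff)
qed

lemma tensor_operator_in_tensor_power:
  assumes "\<And>i. i < m \<Longrightarrow> Vector_Spaces.linear s s (A i)" and "u \<in> tensor_power s m UNIV"
  shows "tensor_operator s m A u \<in> tensor_power s m UNIV"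
proof -
  interpret T: Vector_Spaces.linear tensor_scale tensor_scale "tensor_operator s m A"
    by (rule tensor_operator_linear)
  have "tensor_operator s m A ` tensor_power s m UNIV \<subseteq> tensor_power s m UNIV"
    unfolding tensor_power_def T.span_image[symmetric]
    by (rule tensor.span_mono) (use tensor_operator_elem[OF assms(1)] in auto)
  then show ?thesis using assms(2) by blast
qed

lemma tensor_power_universal:
  fixes t :: "'k::field \<Rightarrow> 'b::ab_group_add \<Rightarrow> 'b" and f :: "(nat \<Rightarrow> 'a::ab_group_add) \<Rightarrow> 'b"
  assumes "vector_space t" and f: "multilinear s t m f"
  obtains g where "Vector_Spaces.linear tensor_scale t g" and "\<And>x. g (elem_tensor s m x) = f x"
proof -
  interpret W: vector_space t by fact
  interpret P: vector_space_pair "tensor_scale :: 'k \<Rightarrow> ('k, 'a) tensor \<Rightarrow> _" t ..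
  interpret K: vector_space "(*) :: 'k \<Rightarrow> 'k \<Rightarrow> 'k"
    by standard (auto simp: algebra_simps)
  interpret D: vector_space_pair t "(*) :: 'k \<Rightarrow> 'k \<Rightarrow> 'k" ..
  obtain B where B: "B \<subseteq> range (elem_tensor s m)" "tensor.independent B"
    "range (elem_tensor s m) \<subseteq> tensor.span B"
    using tensor.maximal_independent_subset by metis
  have "\<forall>b\<in>B. \<exists>x. elem_tensor s m x = b" using B(1) by blast
  then obtain p where p: "\<And>b. b \<in> B \<Longrightarrow> elem_tensor s m (p b) = b" by metis
  obtain g where g: "Vector_Spaces.linear tensor_scale t g" "\<And>b. b \<in> B \<Longrightarrow> g b = f (p b)"
    using P.linear_independent_extend[OF B(2), of "\<lambda>b. f (p b)"] by auto
  have "g (elem_tensor s m x) = f x" for x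
  proof (rule ccontr)
    assume "g (elem_tensor s m x) \<noteq> f x"
    then have "W.independent {g (elem_tensor s m x) - f x}" by simp
    from D.linear_independent_extend[OF this, of "\<lambda>_. 1"] obtain \<psi> where
      psi: "Vector_Spaces.linear t (*) \<psi>" "\<psi> (g (elem_tensor s m x) - f x) = 1" by auto
    have "Vector_Spaces.linear s (*) (\<lambda>v. \<psi> (f (x(i := v))))" if "i < m" for i x
      using Vector_Spaces.linear_compose[of s t "\<lambda>v. f (x(i := v))" "(*)" \<psi>] f psi(1) that
      by (auto simp: multilinear_def o_def)
    then have ml: "multilinear s (*) m (\<lambda>x. \<psi> (f x))"
      using f unfolding multilinear_def by simp metis
    have "u (\<lambda>x. \<psi> (f x)) = \<psi> (g u)" if "u \<in> tensor.span B" for u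
      using that
    proof (induction rule: tensor.span_induct_alt)
      case base
      show ?case
        using module_hom.zero[OF g(1)[unfolded linear_iff_module_hom]]
          module_hom.zero[OF psi(1)[unfolded linear_iff_module_hom]] by (metis zero_fun_apply)
    next
      case (step c b u)
      have "b (\<lambda>x. \<psi> (f x)) = elem_tensor s m (p b) (\<lambda>x. \<psi> (f x))"
        using p step by simp
      also have "\<dots> = \<psi> (g b)" using ml g(2) step by (simp add: elem_tensor_def)
      finally have "b (\<lambda>x. \<psi> (f x)) = \<psi> (g b)" .
      moreover have "\<psi> (g (tensor_scale c b + u)) = c * \<psi> (g b) + \<psi> (g u)"
        by (simp only: module_hom.add[OF g(1)[unfolded linear_iff_module_hom]]
            module_hom.scale[OF g(1)[unfolded linear_iff_module_hom]]
            module_hom.add[OF psi(1)[unfolded linear_iff_module_hom]]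
            module_hom.scale[OF psi(1)[unfolded linear_iff_module_hom]])
      moreover have "(tensor_scale c b + u) (\<lambda>x. \<psi> (f x)) = c * b (\<lambda>x. \<psi> (f x)) + u (\<lambda>x. \<psi> (f x))"
        by (simp add: tensor_scale_def)
      ultimately show ?case using step by metis
    qed
    moreover have "elem_tensor s m x \<in> tensor.span B" using B(3) by blast
    ultimately have "elem_tensor s m x (\<lambda>x. \<psi> (f x)) = \<psi> (g (elem_tensor s m x))"
      by blast
    then have "\<psi> (f x) = \<psi> (g (elem_tensor s m x))"
      using ml by (simp only: elem_tensor_def if_True)
    moreover have "\<psi> (g (elem_tensor s m x)) - \<psi> (f x) = 1"
      using psi(2) unfolding module_hom.diff[OF psi(1)[unfolded linear_iff_module_hom]] .
    ultimately show False by simp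
  qed
  with g(1) show thesis by (rule that)
qed

section \<open>Norms on tensor powers and completions\<close>

definition norm_on_tensors :: "('k::real_normed_field, 'a) tensor set \<Rightarrow> (('k, 'a) tensor \<Rightarrow> real) \<Rightarrow> bool" where
  "norm_on_tensors V \<alpha> \<longleftrightarrow>
     (\<forall>u\<in>V. 0 \<le> \<alpha> u \<and> (\<alpha> u = 0 \<longleftrightarrow> u = 0)) \<and>
     (\<forall>u\<in>V. \<forall>c. \<alpha> (tensor_scale c u) = norm c * \<alpha> u) \<and>
     (\<forall>u\<in>V. \<forall>v\<in>V. \<alpha> (u + v) \<le> \<alpha> u + \<alpha> v)"

definition property_P1 ::
  "('k::real_normed_field \<Rightarrow> 'a::real_normed_vector \<Rightarrow> 'a) \<Rightarrow> nat
    \<Rightarrow> (('k, 'a) tensor \<Rightarrow> real) \<Rightarrow> bool" where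
  "property_P1 s m \<alpha> \<longleftrightarrow>
     (\<forall>A. (\<forall>i<m. bounded_operator s (A i)) \<longrightarrow>
       (\<exists>C. \<forall>u\<in>tensor_power s m UNIV. \<alpha> (tensor_operator s m A u) \<le> C * \<alpha> u))"

text \<open>
  A completion of \<open>V\<close> with the norm \<open>\<alpha>\<close> is a Banach space (the type \<open>'b\<close>) together with a linear
  isometry \<open>\<iota>\<close> of \<open>V\<close> onto a dense subspace. Only the values of \<open>\<iota>\<close> on \<open>V\<close> matter.
\<close>

definition is_completion ::
  "('k::real_normed_field, 'a) tensor set \<Rightarrow> (('k, 'a) tensor \<Rightarrow> real)
    \<Rightarrow> ('k \<Rightarrow> 'b::banach \<Rightarrow> 'b) \<Rightarrow> (('k, 'a) tensor \<Rightarrow> 'b) \<Rightarrow> bool" where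
  "is_completion V \<alpha> t \<iota> \<longleftrightarrow>
     normed_space_over t \<and>
     (\<forall>u\<in>V. \<forall>v\<in>V. \<iota> (u + v) = \<iota> u + \<iota> v) \<and>
     (\<forall>u\<in>V. \<forall>c. \<iota> (tensor_scale c u) = t c (\<iota> u)) \<and>
     (\<forall>u\<in>V. norm (\<iota> u) = \<alpha> u) \<and>
     closure (\<iota> ` V) = UNIV"

end

theory Submission
  imports Defs
begin

text \<open>
  The idea is to separate the subspaces \<open>X\<^sub>1\<^sup>m, \<dots>, X\<^sub>n\<^sup>m\<close> by bounded operators. Suppose that for each
  \<open>i\<close> there is a bounded operator \<open>F\<^sub>i\<close> on \<open>X\<^sup>m\<close> with range in \<open>X\<^sub>i\<^sup>m\<close> that is the identity on
  \<open>X\<^sub>i\<^sup>m\<close> and zero on \<open>X\<^sub>j\<^sup>m\<close> for all \<open>j \<noteq> i\<close>. Applying \<open>F\<^sub>i\<close> to \<open>y\<^sub>1 + \<dots> + y\<^sub>n = 0\<close> gives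
  \<open>y\<^sub>i = 0\<close>, and \<open>F\<^sub>1 + \<dots> + F\<^sub>n\<close> is a projection onto the sum
  (\<open>independent_complemented_if_separated\<close>).

  On \<open>X\<close> itself only pairs can be separated: as \<open>X\<^sub>i\<close>, \<open>X\<^sub>j\<close> and the direct sum \<open>X\<^sub>i + X\<^sub>j\<close> are
  closed, the projection of \<open>X\<^sub>i + X\<^sub>j\<close> onto \<open>X\<^sub>i\<close> along \<open>X\<^sub>j\<close> is bounded by the closed graph
  theorem, and composed with a projection of \<open>X\<close> onto \<open>X\<^sub>i + X\<^sub>j\<close> it gives a bounded operator
  \<open>P\<^sub>i\<^sub>j\<close> on \<open>X\<close> with range in \<open>X\<^sub>i\<close> that is the identity on \<open>X\<^sub>i\<close> and zero on \<open>X\<^sub>j\<close>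
  (\<open>bounded_projection_along\<close>). It need not vanish on the other \<open>X\<^sub>k\<close>.

  The tensor power removes this defect. A tensor product of operators kills \<open>X\<^sub>j \<otimes> \<dots> \<otimes> X\<^sub>j\<close> as
  soon as one factor kills \<open>X\<^sub>j\<close>, while it is the identity on \<open>X\<^sub>i \<otimes> \<dots> \<otimes> X\<^sub>i\<close> if all factors are
  the identity on \<open>X\<^sub>i\<close>. So let \<open>T\<^sub>i\<close> be a tensor product of operators \<open>P\<^sub>i\<^sub>j\<close> in which every
  \<open>j \<noteq> i\<close> occurs. There are \<open>n - 1 \<le> m\<close> such \<open>j\<close>, hence enough slots; any other slot gets a
  projection onto \<open>X\<^sub>i\<close>. By (P1) the operator \<open>T\<^sub>i\<close> is bounded for \<open>\<alpha>\<close>, and its continuous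
  extension to the completion is \<open>F\<^sub>i\<close> (\<open>extend_to_completion\<close>).
\<close>

section \<open>The closed graph theorem\<close>

text \<open>
  By Baire's theorem the sublevel set of \<open>norm \<circ> T\<close> at some level \<open>k\<close> is dense in a ball, and by
  symmetry and convexity it is then dense in a ball of radius \<open>r\<close> around \<open>0\<close>. Approximating a
  vector \<open>x\<close> of norm less than \<open>r\<close> successively writes it as a series whose terms have images of
  norm at most \<open>k / 2\<^sup>j\<close>. The images have a sum, which is \<open>T x\<close> because the graph is closed, so
  \<open>norm (T x) \<le> 2 * k\<close>.
\<close>

theorem closed_graph:
  fixes T :: "'a::banach \<Rightarrow> 'b::banach"
  assumes lin: "linear T"
    and graph: "\<And>x l y. x \<longlonglongrightarrow> l \<Longrightarrow> (\<lambda>j. T (x j)) \<longlonglongrightarrow> y \<Longrightarrow> T l = y"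
  shows "bounded_linear T"
proof -
  interpret T: linear T by fact
  define D where "D k = {x. norm (T x) \<le> real k}" for k
  have "\<exists>k. interior (closure (D k)) \<noteq> {}"
  proof (rule ccontr)
    assume no: "\<not> ?thesis"
    have "euclidean interior_of \<Union>(range (\<lambda>k. closure (D k))) = {}"
    proof (rule Baire_category_alt)
      show "completely_metrizable_space (euclidean :: 'a topology)
        \<or> locally_compact_space (euclidean :: 'a topology) \<and> regular_space (euclidean :: 'a topology)"
        by (simp add: completely_metrizable_space_euclidean)
    qed (use no in auto)
    moreover have "x \<in> closure (D (nat \<lceil>norm (T x)\<rceil>))" for x
      by (rule subsetD[OF closure_subset]) (simp add: D_def real_nat_ceiling_ge)
    then have "\<Union>(range (\<lambda>k. closure (D k))) = UNIV" by blast
    ultimately show False by simp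
  qed
  then obtain k a where "a \<in> interior (closure (D k))" by blast
  then obtain r where r: "r > 0" "ball a r \<subseteq> closure (D k)"
    unfolding mem_interior by blast
  have approx: "\<exists>w. norm (T w) \<le> k \<and> norm (z - w) < e" if z: "norm z < r" and "e > 0" for z e
  proof -
    have "a + z \<in> closure (D k)" "a - z \<in> closure (D k)"
      using z r(2) by (auto simp: dist_norm subset_iff)
    then obtain u v where uv: "u \<in> D k" "dist u (a + z) < e" "v \<in> D k" "dist v (a - z) < e"
      using \<open>e > 0\<close> unfolding closure_approachable by blast
    \<comment> \<open>The centre \<open>a\<close> cancels: \<open>z\<close> is half the difference of \<open>a + z\<close> and \<open>a - z\<close>.\<close>
    define w where "w = (1/2) *\<^sub>R (u - v)"
    have "norm (T w) = (1/2) * norm (T u - T v)"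
      by (simp add: w_def T.scale T.diff)
    also have "\<dots> \<le> k"
      using norm_triangle_ineq4[of "T u" "T v"] uv by (simp add: D_def)
    finally have 1: "norm (T w) \<le> k" .
    have "z - w = (1/2) *\<^sub>R (((a + z) - u) - ((a - z) - v))"
      by (simp add: w_def algebra_simps flip: scaleR_left_distrib)
    then have "norm (z - w) = (1/2) * norm (((a + z) - u) - ((a - z) - v))"
      by simp
    also have "\<dots> < e"
      using norm_triangle_ineq4[of "(a + z) - u" "(a - z) - v"] uv
      by (simp add: dist_norm norm_minus_commute)
    finally show ?thesis using 1 by blast
  qed
  have step: "\<exists>w. norm (T w) \<le> k * (1/2) ^ j \<and> norm (z - w) < r * (1/2) ^ Suc j"
    if z: "norm z < r * (1/2) ^ j" for z and j :: nat
  proof -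
    \<comment> \<open>Rescaling to the ball of radius \<open>r\<close> reduces the step to \<open>approx\<close>.\<close>
    have "norm ((2::real) ^ j *\<^sub>R z) < r" using z by (simp add: field_simps)
    then obtain w where w: "norm (T w) \<le> k" "norm (2 ^ j *\<^sub>R z - w) < r / 2"
      using approx r(1) half_gt_zero by blast
    define w' where "w' = (1/2::real) ^ j *\<^sub>R w"
    have "norm (T w') \<le> k * (1/2) ^ j"
      using w(1) by (simp add: w'_def T.scale mult.commute power_one_over divide_right_mono)
    moreover have "z - w' = (1/2::real) ^ j *\<^sub>R (2 ^ j *\<^sub>R z - w)"
      by (simp add: w'_def algebra_simps power_one_over)
    then have "norm (z - w') = (1/2) ^ j * norm (2 ^ j *\<^sub>R z - w)" by simp
    then have "norm (z - w') < r * (1/2) ^ Suc j"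
      using w(2) by (simp add: field_simps)
    ultimately show ?thesis by blast
  qed
  then have "\<forall>j z. \<exists>w. norm z < r * (1/2) ^ j \<longrightarrow>
      norm (T w) \<le> k * (1/2) ^ j \<and> norm (z - w) < r * (1/2) ^ Suc j" by blast
  then obtain f where f: "\<And>j z. norm z < r * (1/2) ^ j \<Longrightarrow> norm (T (f j z)) \<le> k * (1/2) ^ j"
    "\<And>j z. norm z < r * (1/2) ^ j \<Longrightarrow> norm (z - f j z) < r * (1/2) ^ Suc j"
    by metis
  have bound: "norm (T x) \<le> 2 * k" if x: "norm x < r" for x
  proof -
    \<comment> \<open>\<open>z j\<close> is the remainder after \<open>j\<close> approximation steps.\<close>
    define z where "z = rec_nat x (\<lambda>j y. y - f j y)"
    have z_Suc: "z (Suc j) = z j - f j (z j)" and z_0: "z 0 = x" for j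
      by (simp_all add: z_def)
    have z: "norm (z j) < r * (1/2) ^ j" for j
      by (induction j) (use x f(2) in \<open>auto simp: z_Suc z_0\<close>)
    have "(\<lambda>j. r * (1/2) ^ j) \<longlonglongrightarrow> r * 0"
      by (intro tendsto_intros LIMSEQ_power_zero) auto
    then have "z \<longlonglongrightarrow> 0"
      by (intro Lim_null_comparison[of z "\<lambda>j. r * (1/2) ^ j"] always_eventually)
        (simp_all add: less_imp_le z)
    then have lim: "(\<lambda>j. x - z j) \<longlonglongrightarrow> x"
      using tendsto_diff[OF tendsto_const, of z 0 _ x] by simp
    have partial: "T (x - z j) = (\<Sum>i<j. T (f i (z i)))" for j
      by (induction j) (auto simp: z_0 z_Suc T.diff T.add algebra_simps)
    have geo: "(\<lambda>j. k * (1/2) ^ j) sums (k * 2)"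
      using sums_mult[OF geometric_sums[of "1/2::real"], of "real k"] by simp
    have le: "norm (T (f j (z j))) \<le> k * (1/2) ^ j" for j
      using f(1) z by blast
    have "(\<lambda>j. T (x - z j)) \<longlonglongrightarrow> (\<Sum>j. T (f j (z j)))"
      unfolding partial using summable_LIMSEQ[OF summable_comparison_test'[OF sums_summable[OF geo] le]] .
    then have "T x = (\<Sum>j. T (f j (z j)))"
      by (rule graph[OF lim])
    also have "norm \<dots> \<le> (\<Sum>j. k * (1/2) ^ j)"
      by (rule norm_suminf_le[OF le sums_summable[OF geo]])
    also have "\<dots> = 2 * k" using sums_unique[OF geo] by simp
    finally show ?thesis .
  qed
  show ?thesis
  proof (rule bounded_linear_intro)
    fix x
    show "norm (T x) \<le> norm x * (4 * k / r)"
    proof (cases "x = 0")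
      case False
      define c where "c = r / (2 * norm x)"
      have "c > 0" using False r by (simp add: c_def)
      have "norm (c *\<^sub>R x) < r" using False r by (simp add: c_def)
      from bound[OF this] have "c * norm (T x) \<le> 2 * k"
        using \<open>c > 0\<close> by (simp add: T.scale)
      then show ?thesis using False r by (simp add: c_def field_simps)
    qed (simp add: T.zero)
  qed (simp_all add: T.add T.scale)
qed

section \<open>Bounded operators and complemented subspaces\<close>

lemma bounded_operatorI:
  fixes s :: "'k::real_normed_field \<Rightarrow> 'a::real_normed_vector \<Rightarrow> 'a"
  assumes "normed_space_over s"
    and "\<And>x y. A (x + y) = A x + A y" and "\<And>c x. A (s c x) = s c (A x)"
    and "\<And>x. norm (A x) \<le> C * norm x"
  shows "bounded_operator s A"
proof -
  interpret normed_space_over s by fact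
  have "Vector_Spaces.linear s s A"
    by unfold_locales (simp_all add: assms)
  moreover have "bounded_linear A"
    by (rule bounded_linear_intro[of _ C])
      (use assms(3)[of "of_real _"] assms(2,4) in \<open>simp_all add: scale_of_real mult.commute\<close>)
  ultimately show ?thesis by (simp add: bounded_operator_def)
qed

context normed_space_over
begin

lemma bounded_linear_scale: "bounded_linear (s c)"
proof (rule bounded_linear_intro[of _ "norm c"])
  fix r x
  have "s c (s (of_real r) x) = s (of_real r) (s c x)"
    by (simp add: mult.commute)
  then show "s c (r *\<^sub>R x) = r *\<^sub>R s c x" unfolding scale_of_real .
qed (simp_all add: scale_right_distrib norm_scale mult.commute)

lemma subspace_closure: "subspace (closure S)" if S: "subspace S"
proof (rule subspaceI)
  show "0 \<in> closure S" using closure_subset[of S] subspace_0[OF S] by blast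
  fix c x y assume "x \<in> closure S"
  then obtain x' where x': "\<And>j. x' j \<in> S" "x' \<longlonglongrightarrow> x" unfolding closure_sequential by blast
  have "(\<lambda>j. s c (x' j)) \<longlonglongrightarrow> s c x"
    by (rule bounded_linear.tendsto[OF bounded_linear_scale x'(2)])
  then show "s c x \<in> closure S"
    unfolding closure_sequential
    by (intro exI[of _ "\<lambda>j. s c (x' j)"]) (simp add: subspace_scale[OF S x'(1)])
  assume "y \<in> closure S"
  then obtain y' where y': "\<And>j. y' j \<in> S" "y' \<longlonglongrightarrow> y" unfolding closure_sequential by blast
  show "x + y \<in> closure S"
    unfolding closure_sequential
    by (intro exI[of _ "\<lambda>j. x' j + y' j"])
      (simp add: subspace_add[OF S x'(1) y'(1)] tendsto_add[OF x'(2) y'(2)])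
qed

lemma bounded_operatorD:
  assumes "bounded_operator s A"
  shows "A (x + y) = A x + A y" "A (x - y) = A x - A y" "A (s c x) = s c (A x)" "A 0 = 0"
    "A (sum f I) = (\<Sum>i\<in>I. A (f i))"
    "bounded_linear A" "continuous_on S A"
proof -
  interpret A: bounded_linear A using assms by (simp add: bounded_operator_def)
  interpret L: Vector_Spaces.linear s s A using assms by (simp add: bounded_operator_def)
  show "A (x + y) = A x + A y" "A (x - y) = A x - A y" "A (s c x) = s c (A x)" "A 0 = 0"
    "A (sum f I) = (\<Sum>i\<in>I. A (f i))" "bounded_linear A" "continuous_on S A"
    by (simp_all add: A.add A.diff L.scale A.zero A.sum A.bounded_linear_axioms
        A.continuous_on continuous_on_id)
qed

text \<open>A complemented subspace is the set of fixed points of a continuous map.\<close>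

lemma closed_if_complemented:
  assumes "complemented s M"
  shows "closed M"
proof -
  obtain P where P: "bounded_operator s P" "range P \<subseteq> M" "\<forall>x\<in>M. P x = x"
    using assms unfolding complemented_def by metis
  then have "M = {x. P x = x}" by (metis (mono_tags, lifting) Collect_cong Collect_mem_eq rangeI subsetD)
  moreover have "closed {x. P x = x}"
    by (intro closed_Collect_eq bounded_operatorD(7)[OF P(1)] continuous_on_id)
  ultimately show ?thesis by simp
qed

text \<open>
  The operator \<open>F i\<close> reads off the \<open>i\<close>-th summand of a vector of the sum of the subspaces. So the
  summands are unique, and the sum of the operators \<open>F i\<close> is the identity on that sum.
\<close>

lemma independent_complemented_if_separated:
  assumes "finite I"
    and op: "\<And>i. i \<in> I \<Longrightarrow> bounded_operator s (F i)"
    and into: "\<And>i x. i \<in> I \<Longrightarrow> F i x \<in> Y i"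
    and on: "\<And>i x. i \<in> I \<Longrightarrow> x \<in> Y i \<Longrightarrow> F i x = x"
    and off: "\<And>i j x. i \<in> I \<Longrightarrow> j \<in> I \<Longrightarrow> i \<noteq> j \<Longrightarrow> x \<in> Y j \<Longrightarrow> F i x = 0"
  shows "independent_subspaces I Y \<and> complemented s (\<Sum>i\<in>I. Y i)"
proof
  have pick: "F i (\<Sum>j\<in>I. y j) = y i" if y: "\<forall>j\<in>I. y j \<in> Y j" and "i \<in> I" for y i
  proof -
    have "F i (\<Sum>j\<in>I. y j) = (\<Sum>j\<in>I. F i (y j))"
      by (rule bounded_operatorD(5)[OF op[OF \<open>i \<in> I\<close>]])
    also have "\<dots> = (\<Sum>j\<in>I. if j = i then y i else 0)"
      using y \<open>i \<in> I\<close> on off by (intro sum.cong) auto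
    also have "\<dots> = y i" using \<open>finite I\<close> \<open>i \<in> I\<close> by simp
    finally show ?thesis .
  qed
  show "independent_subspaces I Y"
    unfolding independent_subspaces_def using pick bounded_operatorD(4)[OF op] by metis
  define P where "P x = (\<Sum>i\<in>I. F i x)" for x
  have "Vector_Spaces.linear s s P"
    by unfold_locales
      (simp_all add: P_def bounded_operatorD[OF op] sum.distrib scale_sum_right)
  moreover have "bounded_linear P"
    unfolding P_def by (rule bounded_linear_sum) (rule bounded_operatorD(6)[OF op])
  ultimately have P: "bounded_operator s P" by (simp add: bounded_operator_def)
  have sums: "(\<Sum>i\<in>I. Y i) = {sum y I |y. \<forall>i\<in>I. y i \<in> Y i}"
    by (rule set_sum_alt) fact
  have ran: "range P \<subseteq> (\<Sum>i\<in>I. Y i)"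
    unfolding sums P_def using into by blast
  have fixed: "\<forall>x\<in>(\<Sum>i\<in>I. Y i). P x = x"
    unfolding sums P_def using pick by (auto intro!: sum.cong)
  have "(\<Sum>i\<in>I. Y i) \<subseteq> range P"
  proof
    fix x assume "x \<in> (\<Sum>i\<in>I. Y i)"
    then have "x = P x" using fixed by simp
    then show "x \<in> range P" by (rule range_eqI)
  qed
  with ran have "(\<Sum>i\<in>I. Y i) = range P" by blast
  moreover have "subspace (range P)"
  proof (rule subspaceI)
    show "0 \<in> range P" using bounded_operatorD(4)[OF P] by (metis rangeI)
    show "x + y \<in> range P" if "x \<in> range P" "y \<in> range P" for x y
      using that by (auto simp flip: bounded_operatorD(1)[OF P])
    show "s c x \<in> range P" if "x \<in> range P" for c x
      using that by (auto simp flip: bounded_operatorD(3)[OF P])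
  qed
  ultimately have "subspace (\<Sum>i\<in>I. Y i)" by simp
  then show "complemented s (\<Sum>i\<in>I. Y i)"
    unfolding complemented_def by (intro conjI exI[of _ P] P ran fixed)
qed

end

text \<open>
  With \<open>Q\<close> a projection onto \<open>A + B\<close>, the operator sends \<open>x\<close> to the \<open>A\<close>-component of \<open>Q x\<close>. Its
  boundedness rests on the closed graph theorem: \<open>y = P l\<close> means that \<open>y \<in> A\<close> and \<open>Q l - y \<in> B\<close>,
  and both conditions are preserved by limits since \<open>A\<close> and \<open>B\<close> are closed.
\<close>

lemma bounded_projection_along:
  fixes s :: "'k::real_normed_field \<Rightarrow> 'a::banach \<Rightarrow> 'a"
  assumes "normed_space_over s"
    and A: "complemented s A" and B: "complemented s B" and AB: "complemented s (A + B)"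
    and disj: "A \<inter> B = {0}"
  obtains P where "bounded_operator s P" "range P \<subseteq> A" "\<And>x. x \<in> A \<Longrightarrow> P x = x"
    "\<And>x. x \<in> B \<Longrightarrow> P x = 0"
proof -
  interpret normed_space_over s by fact
  have sub: "subspace A" "subspace B" using A B by (auto simp: complemented_def)
  obtain Q where Q: "bounded_operator s Q" "range Q \<subseteq> A + B" "\<And>x. x \<in> A + B \<Longrightarrow> Q x = x"
    using AB by (auto simp: complemented_def)
  have ex: "\<exists>a. a \<in> A \<and> Q x - a \<in> B" for x
  proof -
    have "Q x \<in> A + B" using Q(2) by blast
    then obtain a b where "a \<in> A" "b \<in> B" "Q x = a + b" by (rule set_plus_elim)
    then show ?thesis by auto
  qed
  then obtain P where P: "\<And>x. P x \<in> A" "\<And>x. Q x - P x \<in> B" by metis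
  have unique: "P x = a" if "a \<in> A" "Q x - a \<in> B" for x a
  proof -
    have "P x - a \<in> A" using that P(1) subspace_diff[OF sub(1)] by blast
    moreover have "(Q x - a) - (Q x - P x) \<in> B" using that P(2) subspace_diff[OF sub(2)] by blast
    ultimately have "P x - a \<in> A \<inter> B" by simp
    then show ?thesis using disj by simp
  qed
  have add: "P (x + y) = P x + P y" for x y
  proof (rule unique)
    show "P x + P y \<in> A" using P(1) subspace_add[OF sub(1)] by blast
    have "(Q x - P x) + (Q y - P y) \<in> B" using P(2) subspace_add[OF sub(2)] by blast
    then show "Q (x + y) - (P x + P y) \<in> B"
      by (simp add: bounded_operatorD(1)[OF Q(1)] algebra_simps)
  qed
  have scale: "P (s c x) = s c (P x)" for c x
  proof (rule unique)
    show "s c (P x) \<in> A" using P(1) subspace_scale[OF sub(1)] by blast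
    have "s c (Q x - P x) \<in> B" using P(2) subspace_scale[OF sub(2)] by blast
    then show "Q (s c x) - s c (P x) \<in> B"
      by (simp add: bounded_operatorD(3)[OF Q(1)] scale_right_diff_distrib)
  qed
  have "linear P"
    by (rule linearI) (use add scale[of "of_real _"] in \<open>simp_all add: scale_of_real\<close>)
  then have "bounded_linear P"
  proof (rule closed_graph)
    fix x l y assume x: "x \<longlonglongrightarrow> l" "(\<lambda>j. P (x j)) \<longlonglongrightarrow> y"
    show "P l = y"
    proof (rule unique)
      show "y \<in> A"
        using closed_sequentially[OF closed_if_complemented[OF A] _ x(2)] P(1) by blast
      have "(\<lambda>j. Q (x j) - P (x j)) \<longlonglongrightarrow> Q l - y"
        by (intro tendsto_diff bounded_linear.tendsto[OF bounded_operatorD(6)[OF Q(1)]] x)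
      then show "Q l - y \<in> B"
        by (rule closed_sequentially[OF closed_if_complemented[OF B] P(2)])
    qed
  qed
  moreover have "Vector_Spaces.linear s s P"
    by unfold_locales (simp_all add: add scale)
  ultimately have "bounded_operator s P" by (simp add: bounded_operator_def)
  moreover have "P x = x" if "x \<in> A" for x
  proof (rule unique[OF that])
    have "Q x = x" using Q(3) set_plus_intro[OF that subspace_0[OF sub(2)]] by simp
    then show "Q x - x \<in> B" using subspace_0[OF sub(2)] by simp
  qed
  moreover have "P x = 0" if "x \<in> B" for x
  proof (rule unique)
    show "0 \<in> A" using subspace_0[OF sub(1)] .
    have "Q x = x" using Q(3) set_plus_intro[OF subspace_0[OF sub(1)] that] by simp
    then show "Q x - 0 \<in> B" using that by simp
  qed
  ultimately show thesis using P(1) that by blast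
qed

section \<open>Tensor products of operators on tensor powers of subspaces\<close>

lemma tensor_power_mono: "tensor_power s m M \<subseteq> tensor_power s m N" if "M \<subseteq> N"
  unfolding tensor_power_def by (rule tensor.span_mono) (use that in blast)

lemma tensor_power_subspace: "tensor.subspace (tensor_power s m M)"
  unfolding tensor_power_def by (rule tensor.subspace_span)

lemma elem_tensor_cong:
  assumes "vector_space s" and "\<And>k. k < m \<Longrightarrow> x k = y k"
  shows "elem_tensor s m x = elem_tensor s m y"
proof -
  have "\<forall>x y. (\<forall>i<m. x i = y i) \<longrightarrow> elem_tensor s m x = elem_tensor s m y"
    using multilinear_elem_tensor[OF assms(1)] unfolding multilinear_def by (rule conjunct1)
  from this[rule_format, of x y] assms(2) show ?thesis by simp
qed

lemma elem_tensor_eq_0: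
  assumes "vector_space s" and "k < m" "x k = 0"
  shows "elem_tensor s m x = 0"
proof -
  have "\<forall>i<m. \<forall>x. Vector_Spaces.linear s tensor_scale (\<lambda>v. elem_tensor s m (x(i := v)))"
    using multilinear_elem_tensor[OF assms(1)] unfolding multilinear_def by (rule conjunct2)
  from this[rule_format, OF assms(2), of x]
  interpret E: Vector_Spaces.linear s tensor_scale "\<lambda>v. elem_tensor s m (x(k := v))" .
  have "x(k := 0) = x" using assms(3) by auto
  then show ?thesis using E.zero by simp
qed

lemma tensor_operator_maps:
  assumes "\<And>k. k < m \<Longrightarrow> Vector_Spaces.linear s s (A k)"
    and "\<And>k x. k < m \<Longrightarrow> x \<in> M \<Longrightarrow> A k x \<in> N"
    and "u \<in> tensor_power s m M"
  shows "tensor_operator s m A u \<in> tensor_power s m N"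
proof -
  interpret T: Vector_Spaces.linear tensor_scale tensor_scale "tensor_operator s m A"
    by (rule tensor_operator_linear)
  have gen: "tensor_operator s m A (elem_tensor s m x) = elem_tensor s m (\<lambda>k. A k (x k))" for x
    using tensor_operator_elem[of m s A] assms(1) by blast
  have "tensor_operator s m A ` {elem_tensor s m x | x. \<forall>k<m. x k \<in> M}
      \<subseteq> {elem_tensor s m x | x. \<forall>k<m. x k \<in> N}"
  proof
    fix v assume "v \<in> tensor_operator s m A ` {elem_tensor s m x | x. \<forall>k<m. x k \<in> M}"
    then obtain x where "v = elem_tensor s m (\<lambda>k. A k (x k))" "\<forall>k<m. A k (x k) \<in> N"
      using gen assms(2) by blast
    then show "v \<in> {elem_tensor s m x | x. \<forall>k<m. x k \<in> N}" by blast
  qed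
  then have "tensor_operator s m A ` tensor_power s m M \<subseteq> tensor_power s m N"
    unfolding tensor_power_def T.span_image[symmetric] by (rule tensor.span_mono)
  then show ?thesis using assms(3) by blast
qed

lemma tensor_operator_eq_self:
  assumes "vector_space s" and "\<And>k. k < m \<Longrightarrow> Vector_Spaces.linear s s (A k)"
    and "\<And>k x. k < m \<Longrightarrow> x \<in> M \<Longrightarrow> A k x = x"
    and "u \<in> tensor_power s m M"
  shows "tensor_operator s m A u = u"
proof -
  interpret T: Vector_Spaces.linear tensor_scale tensor_scale "tensor_operator s m A"
    by (rule tensor_operator_linear)
  have "tensor_operator s m A (elem_tensor s m x) = elem_tensor s m x" if "\<forall>k<m. x k \<in> M" for x
  proof -
    have "elem_tensor s m (\<lambda>k. A k (x k)) = elem_tensor s m x"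
      by (rule elem_tensor_cong[OF assms(1)]) (use that assms(3) in blast)
    then show ?thesis using tensor_operator_elem[of m s A x] assms(2) by simp
  qed
  then have "{elem_tensor s m x |x. \<forall>k<m. x k \<in> M} \<subseteq> {u. tensor_operator s m A u = u}" by blast
  moreover have "tensor.subspace {u. tensor_operator s m A u = u}"
    by (rule tensor.subspaceI) (simp_all only: mem_Collect_eq T.add T.scale T.zero)
  ultimately have "tensor_power s m M \<subseteq> {u. tensor_operator s m A u = u}"
    unfolding tensor_power_def by (rule tensor.span_minimal)
  then show ?thesis using assms(4) by blast
qed

text \<open>
  A single slot suffices: every elementary tensor over \<open>M\<close> is sent to an elementary tensor with
  factor \<open>0\<close> in slot \<open>k\<close>.
\<close>

lemma tensor_operator_eq_0:
  assumes "vector_space s" and "\<And>k. k < m \<Longrightarrow> Vector_Spaces.linear s s (A k)"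
    and k: "k < m" "\<And>x. x \<in> M \<Longrightarrow> A k x = 0"
    and "u \<in> tensor_power s m M"
  shows "tensor_operator s m A u = 0"
proof -
  interpret T: Vector_Spaces.linear tensor_scale tensor_scale "tensor_operator s m A"
    by (rule tensor_operator_linear)
  have "tensor_operator s m A (elem_tensor s m x) = 0" if x: "\<forall>k<m. x k \<in> M" for x
  proof -
    have "elem_tensor s m (\<lambda>k. A k (x k)) = 0"
      by (rule elem_tensor_eq_0[OF assms(1) k(1)]) (use x k in blast)
    then show ?thesis using tensor_operator_elem[of m s A x] assms(2) by simp
  qed
  then have "{elem_tensor s m x |x. \<forall>k<m. x k \<in> M} \<subseteq> {u. tensor_operator s m A u = 0}" by blast
  moreover have "tensor.subspace {u. tensor_operator s m A u = 0}"
    by (rule tensor.subspaceI)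
      (simp_all only: mem_Collect_eq T.add T.scale T.zero tensor.scale_zero_right add_0)
  ultimately have "tensor_power s m M \<subseteq> {u. tensor_operator s m A u = 0}"
    unfolding tensor_power_def by (rule tensor.span_minimal)
  then show ?thesis using assms(5) by blast
qed

section \<open>Extension of operators to the completion\<close>

text \<open>
  The operator that \<open>T\<close> induces on the dense subspace \<open>\<iota> ` V\<close> is Lipschitz continuous, hence
  extends continuously; linearity and the norm bound persist because they are closed conditions.
\<close>

lemma extend_to_completion:
  fixes t :: "'k::real_normed_field \<Rightarrow> 'b::banach \<Rightarrow> 'b" and V :: "('k, 'a) tensor set"
  assumes compl: "is_completion V \<alpha> t \<iota>"
    and V: "tensor.subspace V"
    and T: "Vector_Spaces.linear tensor_scale tensor_scale T"
    and into: "\<And>u. u \<in> V \<Longrightarrow> T u \<in> V"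
    and bd: "\<And>u. u \<in> V \<Longrightarrow> \<alpha> (T u) \<le> C * \<alpha> u"
  shows "\<exists>F. bounded_operator t F \<and> (\<forall>u\<in>V. F (\<iota> u) = \<iota> (T u))"
proof -
  interpret T: Vector_Spaces.linear tensor_scale tensor_scale T by fact
  have t: "normed_space_over t" using compl by (simp add: is_completion_def)
  interpret normed_space_over t by fact
  have add: "\<iota> (u + v) = \<iota> u + \<iota> v" if "u \<in> V" "v \<in> V" for u v
    using compl that by (auto simp: is_completion_def)
  have scale: "\<iota> (tensor_scale c u) = t c (\<iota> u)" and norm: "norm (\<iota> u) = \<alpha> u" if "u \<in> V" for u c
    using compl that by (auto simp: is_completion_def)
  have dense: "x \<in> S" if "closed S" "\<And>u. u \<in> V \<Longrightarrow> \<iota> u \<in> S" for S x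
    using compl closure_minimal[of "\<iota> ` V" S] that unfolding is_completion_def by blast
  have diff: "\<iota> (u - v) = \<iota> u - \<iota> v" if "u \<in> V" "v \<in> V" for u v
    using add[of "u - v" v] that tensor.subspace_diff[OF V] by (simp add: algebra_simps)
  \<comment> \<open>As \<open>C\<close> may be negative, the Lipschitz constant is its absolute value.\<close>
  have lip: "norm (\<iota> (T u) - \<iota> (T v)) \<le> \<bar>C\<bar> * norm (\<iota> u - \<iota> v)" if uv: "u \<in> V" "v \<in> V" for u v
  proof -
    have d: "u - v \<in> V" using tensor.subspace_diff[OF V] uv by blast
    have "norm (\<iota> (T u) - \<iota> (T v)) = \<alpha> (T (u - v))"
      using diff[OF into into] norm[OF into[OF d]] uv by (simp add: T.diff)
    also have "\<dots> \<le> C * \<alpha> (u - v)" by (rule bd[OF d])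
    also have "\<dots> \<le> \<bar>C\<bar> * norm (\<iota> (u - v))"
      unfolding norm[OF d, symmetric] by (intro mult_right_mono) auto
    finally show ?thesis using diff uv by simp
  qed
  define g where "g y = \<iota> (T (inv_into V \<iota> y))" for y
  \<comment> \<open>Independence of the chosen preimage is the case of \<open>lip\<close> with equal images under \<open>\<iota>\<close>.\<close>
  have g: "g (\<iota> u) = \<iota> (T u)" if "u \<in> V" for u
  proof -
    have "inv_into V \<iota> (\<iota> u) \<in> V" "\<iota> (inv_into V \<iota> (\<iota> u)) = \<iota> u"
      using that by (simp_all add: inv_into_into f_inv_into_f)
    then show ?thesis using lip[of "inv_into V \<iota> (\<iota> u)" u] that by (simp add: g_def)
  qed
  have "\<bar>C\<bar>-lipschitz_on (\<iota> ` V) g"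
    by (rule lipschitz_onI) (auto simp: g dist_norm lip)
  from uniformly_continuous_on_extension_on_closure[OF lipschitz_on_uniformly_continuous[OF this]]
  obtain F where F: "uniformly_continuous_on (closure (\<iota> ` V)) F" "\<And>x. x \<in> \<iota> ` V \<Longrightarrow> g x = F x"
    by metis
  have cont: "continuous_on UNIV F"
    using uniformly_continuous_imp_continuous[OF F(1)] compl by (simp add: is_completion_def)
  have cont': "continuous_on UNIV (\<lambda>x. F (h x))" if "continuous_on UNIV h" for h :: "'b \<Rightarrow> 'b"
    using continuous_on_compose2[OF cont that] by auto
  have FV: "F (\<iota> u) = \<iota> (T u)" if "u \<in> V" for u
    using F(2)[of "\<iota> u"] g that by simp
  have add_V: "F (\<iota> u + \<iota> v) = F (\<iota> u) + F (\<iota> v)" if "u \<in> V" "v \<in> V" for u v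
    using that tensor.subspace_add[OF V] by (simp add: FV T.add into add flip: add)
  \<comment> \<open>Additivity passes to the closure in one argument at a time.\<close>
  have add_half: "F (x + \<iota> v) = F x + F (\<iota> v)" if "v \<in> V" for x v
  proof -
    have "closed {x. F (x + \<iota> v) = F x + F (\<iota> v)}"
      by (intro closed_Collect_eq cont' cont continuous_intros)
    from dense[OF this, of x] add_V that show ?thesis by simp
  qed
  have F_add: "F (x + y) = F x + F y" for x y
  proof -
    have "closed {y. F (x + y) = F x + F y}"
      by (intro closed_Collect_eq cont' cont continuous_intros)
    from dense[OF this, of y] add_half show ?thesis by simp
  qed
  have scale_V: "F (t c (\<iota> u)) = t c (F (\<iota> u))" if "u \<in> V" for c u
    using that tensor.subspace_scale[OF V] by (simp add: FV T.scale into scale flip: scale)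
  have t_cont: "continuous_on UNIV (\<lambda>x. t c (h x))" if "continuous_on UNIV h" for c and h :: "'b \<Rightarrow> 'b"
    by (rule bounded_linear.continuous_on[OF bounded_linear_scale that])
  have F_scale: "F (t c x) = t c (F x)" for c x
  proof -
    have "closed {x. F (t c x) = t c (F x)}"
      by (intro closed_Collect_eq cont' t_cont cont continuous_on_id)
    from dense[OF this, of x] scale_V show ?thesis by simp
  qed
  have "0 \<in> V" using tensor.subspace_0[OF V] .
  then have "\<iota> 0 = 0" using diff[of 0 0] by simp
  then have "norm (F (\<iota> u)) \<le> \<bar>C\<bar> * norm (\<iota> u)" if "u \<in> V" for u
    using lip[OF that \<open>0 \<in> V\<close>] that by (simp add: FV T.zero)
  then have F_norm: "norm (F x) \<le> \<bar>C\<bar> * norm x" for x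
    using dense[of "{x. norm (F x) \<le> \<bar>C\<bar> * norm x}" x]
    by (simp add: closed_Collect_le continuous_on_mult_left continuous_on_norm continuous_on_id cont)
  have "bounded_operator t F"
    by (rule bounded_operatorI[OF t]) (fact F_add F_scale F_norm)+
  then show ?thesis using FV by blast
qed

section \<open>Independence and complementation of tensor powers\<close>

theorem theorem4p1:
  fixes s :: "'k::real_normed_field \<Rightarrow> 'a::banach \<Rightarrow> 'a"
    and X :: "nat \<Rightarrow> 'a set"
    and n m :: nat
    and \<alpha> :: "('k, 'a) tensor \<Rightarrow> real"
    and t :: "'k \<Rightarrow> 'b::banach \<Rightarrow> 'b"
    and \<iota> :: "('k, 'a) tensor \<Rightarrow> 'b"
  assumes "normed_space_over s"
    and "\<And>i. i \<in> {1..n} \<Longrightarrow> complemented s (X i)"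
    and "m \<ge> 1"
    and "norm_on_tensors (tensor_power s m UNIV) \<alpha>"
    and "property_P1 s m \<alpha>"
    and "is_completion (tensor_power s m UNIV) \<alpha> t \<iota>"
    and "n \<le> m + 1"
    and "\<And>i j. i \<in> {1..n} \<Longrightarrow> j \<in> {1..n} \<Longrightarrow> i \<noteq> j \<Longrightarrow>
           X i \<inter> X j = {0} \<and> complemented s (X i + X j)"
  shows "independent_subspaces {1..n} (\<lambda>i. closure (\<iota> ` tensor_power s m (X i))) \<and>
         complemented t (\<Sum>i\<in>{1..n}. closure (\<iota> ` tensor_power s m (X i)))"
proof -
  interpret S: normed_space_over s by fact
  have vs: "vector_space s" ..
  have t: "normed_space_over t" using assms(6) by (simp add: is_completion_def)
  interpret N: normed_space_over t by fact
  let ?V = "tensor_power s m UNIV"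
  \<comment> \<open>For \<open>j = i\<close> and for \<open>j\<close> outside \<open>{1..n}\<close>, which serve to fill spare slots, \<open>separates\<close> only
    asks for a projection onto \<open>X i\<close>.\<close>
  define separates where "separates i j P \<longleftrightarrow> bounded_operator s P \<and> range P \<subseteq> X i \<and>
      (\<forall>x\<in>X i. P x = x) \<and> (j \<in> {1..n} \<longrightarrow> i \<noteq> j \<longrightarrow> (\<forall>x\<in>X j. P x = 0))" for i j P
  have "\<exists>P. separates i j P" if i: "i \<in> {1..n}" for i j
  proof (cases "j \<in> {1..n} \<and> i \<noteq> j")
    case True
    then have j: "complemented s (X j)" "complemented s (X i + X j)" "X i \<inter> X j = {0}"
      using i assms(2,8) by blast+
    obtain P where "bounded_operator s P" "range P \<subseteq> X i" "\<And>x. x \<in> X i \<Longrightarrow> P x = x"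
        "\<And>x. x \<in> X j \<Longrightarrow> P x = 0"
      by (rule bounded_projection_along[OF assms(1) assms(2)[OF i] j]) blast
    then show ?thesis unfolding separates_def by blast
  next
    case False
    with assms(2)[OF i] show ?thesis unfolding complemented_def separates_def by blast
  qed
  note separator = this
  define P where "P i j = (SOME P. separates i j P)" for i j
  have "separates i j (P i j)" if "i \<in> {1..n}" for i j
    unfolding P_def by (rule someI_ex[OF separator[OF that]])
  then have P: "\<And>i j. i \<in> {1..n} \<Longrightarrow> bounded_operator s (P i j)"
    "\<And>i j x. i \<in> {1..n} \<Longrightarrow> P i j x \<in> X i"
    "\<And>i j x. i \<in> {1..n} \<Longrightarrow> x \<in> X i \<Longrightarrow> P i j x = x"
    "\<And>i j x. i \<in> {1..n} \<Longrightarrow> j \<in> {1..n} \<Longrightarrow> i \<noteq> j \<Longrightarrow> x \<in> X j \<Longrightarrow> P i j x = 0"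
    unfolding separates_def by blast+
  \<comment> \<open>Slots are counted from \<open>0\<close>, indices from \<open>1\<close>: the slots \<open>0, 1, \<dots>\<close> are assigned the indices
    \<open>1, 2, \<dots>\<close> with \<open>i\<close> left out. The last slots may get indices beyond \<open>n\<close>.\<close>
  define A where "A i k = P i (if k + 1 < i then k + 1 else k + 2)" for i k
  have lin: "Vector_Spaces.linear s s (A i k)" if "i \<in> {1..n}" for i k
    using P(1)[OF that] by (simp add: A_def bounded_operator_def)
  define T where "T i = tensor_operator s m (A i)" for i
  have T_into: "T i u \<in> tensor_power s m (X i)" if "i \<in> {1..n}" "u \<in> ?V" for i u
    unfolding T_def
    by (rule tensor_operator_maps[OF lin _ that(2)]) (use that P(2) in \<open>auto simp: A_def\<close>)
  have T_on: "T i u = u" if "i \<in> {1..n}" "u \<in> tensor_power s m (X i)" for i u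
    unfolding T_def
    by (rule tensor_operator_eq_self[OF vs lin _ that(2)]) (use that P(3) in \<open>auto simp: A_def\<close>)
  have T_off: "T i u = 0" if ij: "i \<in> {1..n}" "j \<in> {1..n}" "i \<noteq> j" "u \<in> tensor_power s m (X j)" for i j u
  proof -
    \<comment> \<open>The slot to which \<open>j\<close> is assigned; it is below \<open>m\<close> because \<open>n - 1 \<le> m\<close>.\<close>
    define k where "k = (if j < i then j - 1 else j - 2)"
    have k: "k < m" "(if k + 1 < i then k + 1 else k + 2) = j"
      using ij assms(7) by (auto simp: k_def)
    show ?thesis unfolding T_def
      by (rule tensor_operator_eq_0[OF vs lin k(1) _ ij(4)])
        (use ij P(4) k(2) in \<open>auto simp only: A_def\<close>)
  qed
  have sub_V: "tensor_power s m (X i) \<subseteq> ?V" for i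
    by (rule tensor_power_mono) simp
  have "\<exists>F. bounded_operator t F \<and> (\<forall>u\<in>?V. F (\<iota> u) = \<iota> (T i u))" if i: "i \<in> {1..n}" for i
  proof -
    have "\<forall>k<m. bounded_operator s (A i k)" using P(1)[OF i] by (simp add: A_def)
    then obtain C where C: "\<And>u. u \<in> ?V \<Longrightarrow> \<alpha> (T i u) \<le> C * \<alpha> u"
      using assms(5) unfolding property_P1_def T_def by blast
    have into: "T i u \<in> ?V" if "u \<in> ?V" for u
      using T_into[OF i that] sub_V by blast
    have T_lin: "Vector_Spaces.linear tensor_scale tensor_scale (T i)"
      unfolding T_def by (rule tensor_operator_linear)
    show ?thesis
      by (rule extend_to_completion[where V = ?V and T = "T i" and C = C,
            OF assms(6) tensor_power_subspace T_lin]) (fact into C)+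
  qed
  then have "\<forall>i\<in>{1..n}. \<exists>F. bounded_operator t F \<and> (\<forall>u\<in>?V. F (\<iota> u) = \<iota> (T i u))"
    by (rule ballI)
  from bchoice[OF this]
  obtain F where "\<forall>i\<in>{1..n}. bounded_operator t (F i) \<and> (\<forall>u\<in>?V. F i (\<iota> u) = \<iota> (T i u))" ..
  then have F: "\<And>i. i \<in> {1..n} \<Longrightarrow> bounded_operator t (F i)"
    "\<And>i u. i \<in> {1..n} \<Longrightarrow> u \<in> ?V \<Longrightarrow> F i (\<iota> u) = \<iota> (T i u)"
    by blast+
  have dense: "closure (\<iota> ` ?V) = UNIV" using assms(6) by (simp add: is_completion_def)
  have "\<iota> (0 + 0) = \<iota> 0 + \<iota> 0"
    using assms(6) tensor.subspace_0[OF tensor_power_subspace] unfolding is_completion_def by blast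
  then have iota_0: "\<iota> 0 = 0" by simp
  show ?thesis
  proof (rule N.independent_complemented_if_separated)
    fix i x assume i: "i \<in> {1..n}"
    have "F i ` closure (\<iota> ` ?V) \<subseteq> closure (\<iota> ` tensor_power s m (X i))"
      by (rule image_closure_subset[OF N.bounded_operatorD(7)[OF F(1)[OF i]] closed_closure])
        (use F(2)[OF i] T_into[OF i] closure_subset in fastforce)
    then show "F i x \<in> closure (\<iota> ` tensor_power s m (X i))" using dense by blast
    show "F i x = x" if "x \<in> closure (\<iota> ` tensor_power s m (X i))"
    proof -
      have "closed {x. F i x = x}"
        by (intro closed_Collect_eq N.bounded_operatorD(7)[OF F(1)[OF i]] continuous_on_id)
      moreover have "\<iota> ` tensor_power s m (X i) \<subseteq> {x. F i x = x}"
        using F(2)[OF i] T_on[OF i] subsetD[OF sub_V] by auto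
      ultimately show ?thesis using that closure_minimal by blast
    qed
    show "F i x = 0" if j: "j \<in> {1..n}" "i \<noteq> j" "x \<in> closure (\<iota> ` tensor_power s m (X j))" for j
    proof -
      have "closed {x. F i x = 0}"
        by (intro closed_Collect_eq N.bounded_operatorD(7)[OF F(1)[OF i]] continuous_on_const)
      moreover have "\<iota> ` tensor_power s m (X j) \<subseteq> {x. F i x = 0}"
        using F(2)[OF i] T_off[OF i j(1,2)] subsetD[OF sub_V] iota_0 by (auto simp del: zero_fun_def)
      ultimately show ?thesis using j(3) closure_minimal by blast
    qed
  qed (use F(1) in auto)
qed

end
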